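(* Let $q:\Theta\to[0,\infty)$ be a density function with $\int_\Theta\pi^{1-\epsilon}(\theta)q^{\epsilon}(\theta)\,d\theta<\infty$, let $r(\theta)=q(\theta)/\pi(\theta)$, and consider the geometrically contaminated prior density $$\pi_\epsilon(\theta)=\frac{\pi^{1-\epsilon}(\theta)q^{\epsilon}(\theta)}{\int_\Theta\pi^{1-\epsilon}(\theta)q^{\epsilon}(\theta)\,d\theta}=\frac{r^\epsilon(\theta)\pi(\theta)}{E_\pi(r^\epsilon)}.$$ Let $RB_\epsilon(\theta\,|\,x)=f_{\theta,T}(T(x))/m_{\epsilon,T}(T(x))$ be the relative belief ratio at $\theta$ and $$BF_\epsilon(\theta\,|\,x)=\frac{(1-\pi_\epsilon(\theta))RB_\epsilon(\theta\,|\,x)}{1-\pi_\epsilon(\theta)RB_\epsilon(\theta\,|\,x)}$$ the Bayes factor at $\theta$, both based on $\pi_\epsilon$, and let $BF(\theta\,|\,x)$ be the Bayes factor at $\theta$ based on $\pi$ (the case $\epsilon=0$). Then, under this geometric contamination of the prior, $$\left.\frac{\partial\log BF_\epsilon(\theta\,|\,x)}{\partial\epsilon}\right\vert_{\epsilon=0}=-\left.\frac{\partial\log RB_\epsilon(\theta\,|\,x)}{\partial\epsilon}\right\vert_{\epsilon=0}\left(1+\frac{\pi(\theta)}{1-\pi(\theta)}BF(\theta\,|\,x)\right)+(E_\pi(\log r)-\log r(\theta))\left(\frac{\pi(\theta)}{1-\pi(\theta)}\right)\left(1-BF(\theta\,|\,x)\right).$$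
   Context: $T$ is a minimal sufficient statistic for a statistical model with parameter space $\Theta$, and $x$ is the observed data; $f_{\theta,T}$ is the sampling density of $T$ under $\theta$. The prior $\Pi$ on $\Theta$ has density $\pi$ with respect to a support measure denoted $d\theta$ (counting measure in the discrete case), and $q$ is a density with respect to the same measure. The point $\theta$ at which sensitivity to the prior is assessed satisfies $0<\Pi(\{\theta\})=\pi(\theta)<1$. $E_\pi$ denotes expectation with respect to the prior $\pi$. The prior predictive densities of $T$ based on $\pi$ and on $\pi_\epsilon$ are $m_T(t)=\int_\Theta f_{\theta,T}(t)\pi(\theta)\,d\theta$ and $m_{\epsilon,T}(t)=\int_\Theta f_{\theta,T}(t)\pi_\epsilon(\theta)\,d\theta$. The conditions of the dominated derivative theorem are assumed, so that derivatives with respect to $\epsilon$ may be taken inside the integrals defining $m_{\epsilon,T}$ and $E_\pi(r^\epsilon)$.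
   Formalization: The first term is proved with a plus sign instead of the printed minus, which is false in general (two-point Θ, π=(1/2,1/2), q=(3/4,1/4), likelihoods 2/3, 1/3); f_{θ,T}(T(x))>0 and posterior probability of θ not equal to 1 are made explicit so the logarithms exist. *)

theory Defs
  imports "HOL-Probability.Probability"
begin

text \<open>A statistical model consists of the probability measures \<open>P \<theta>\<close>, \<open>\<theta> \<in> \<Theta>\<close>, on the sample
  space \<open>X\<close>.  A statistic \<open>S\<close> takes values in a measurable space \<open>K\<close> (only the \<open>\<sigma>\<close>-algebra of \<open>X\<close>
  and \<open>K\<close> matters).\<close>

definition statistical_model :: "'p set \<Rightarrow> ('p \<Rightarrow> 'x measure) \<Rightarrow> 'x measure \<Rightarrow> bool" where
  "statistical_model \<Theta> P X \<longleftrightarrow> (\<forall>\<theta>\<in>\<Theta>. prob_space (P \<theta>) \<and> sets (P \<theta>) = sets X)"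

text \<open>The conditional probability of each event given \<open>S\<close> has a version \<open>g \<circ> S\<close> not depending on \<open>\<theta>\<close>.\<close>

definition sufficient_statistic ::
  "'p set \<Rightarrow> ('p \<Rightarrow> 'x measure) \<Rightarrow> 'x measure \<Rightarrow> 's measure \<Rightarrow> ('x \<Rightarrow> 's) \<Rightarrow> bool" where
  "sufficient_statistic \<Theta> P X K S \<longleftrightarrow> S \<in> measurable X K \<and>
     (\<forall>A\<in>sets X. \<exists>g\<in>borel_measurable K. \<forall>\<theta>\<in>\<Theta>. AE x in P \<theta>.
        real_cond_exp (P \<theta>) (vimage_algebra (space X) S K) (indicator A) x = g (S x))"

text \<open>\<open>T\<close> is a function of every sufficient statistic, up to null sets.  A definition cannot quantify
  over the value type of the competing statistic, but statistics with values in the sample type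
  suffice: mapping each value of a statistic to a chosen preimage, and transporting the
  \<open>\<sigma>\<close>-algebra, gives such a statistic that generates the same sub-\<open>\<sigma>\<close>-algebra of \<open>X\<close> and has
  the same level sets.\<close>

definition minimal_sufficient_statistic ::
  "'p set \<Rightarrow> ('p \<Rightarrow> 'x measure) \<Rightarrow> 'x measure \<Rightarrow> 't measure \<Rightarrow> ('x \<Rightarrow> 't) \<Rightarrow> bool" where
  "minimal_sufficient_statistic \<Theta> P X N T \<longleftrightarrow> sufficient_statistic \<Theta> P X N T \<and>
     (\<forall>(S :: 'x \<Rightarrow> 'x) K. sufficient_statistic \<Theta> P X K S \<longrightarrow>
        (\<exists>h. \<forall>\<theta>\<in>\<Theta>. AE x in P \<theta>. T x = h (S x)))"

definition is_density :: "'p measure \<Rightarrow> ('p \<Rightarrow> real) \<Rightarrow> bool" where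
  "is_density \<mu> p \<longleftrightarrow> p \<in> borel_measurable \<mu> \<and> (\<forall>\<theta>\<in>space \<mu>. 0 \<le> p \<theta>) \<and>
     (\<integral>\<^sup>+\<theta>. ennreal (p \<theta>) \<partial>\<mu>) = 1"

definition prior_measure :: "'p measure \<Rightarrow> ('p \<Rightarrow> real) \<Rightarrow> 'p measure" where
  "prior_measure \<mu> p = density \<mu> (\<lambda>\<theta>. ennreal (p \<theta>))"

definition prior_predictive :: "'p measure \<Rightarrow> ('p \<Rightarrow> 't \<Rightarrow> real) \<Rightarrow> ('p \<Rightarrow> real) \<Rightarrow> 't \<Rightarrow> real" where
  "prior_predictive \<mu> f p t = (\<integral>\<theta>. f \<theta> t * p \<theta> \<partial>\<mu>)"

definition relative_belief ::
  "'p measure \<Rightarrow> ('p \<Rightarrow> 't \<Rightarrow> real) \<Rightarrow> ('p \<Rightarrow> real) \<Rightarrow> 'p \<Rightarrow> 't \<Rightarrow> real" where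
  "relative_belief \<mu> f p \<theta> t = f \<theta> t / prior_predictive \<mu> f p t"

text \<open>Posterior odds over prior odds.  As \<open>log BF = log (1 - p) + log RB - log (1 - p RB)\<close> with
  \<open>p = p \<theta>\<close>, and \<open>1 / (1 - p RB) = 1 + p / (1 - p) BF\<close>, the logarithmic derivative of \<open>RB\<close>
  enters that of \<open>BF\<close> with the coefficient \<open>+(1 + p / (1 - p) BF)\<close>.\<close>

definition bayes_factor ::
  "'p measure \<Rightarrow> ('p \<Rightarrow> 't \<Rightarrow> real) \<Rightarrow> ('p \<Rightarrow> real) \<Rightarrow> 'p \<Rightarrow> 't \<Rightarrow> real" where
  "bayes_factor \<mu> f p \<theta> t =
     (1 - p \<theta>) * relative_belief \<mu> f p \<theta> t / (1 - p \<theta> * relative_belief \<mu> f p \<theta> t)"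

text \<open>\<open>powr\<close> satisfies \<open>0 powr 0 = 0\<close>.  The usual convention \<open>0\<^sup>0 = 1\<close> is needed here: with it the
  contaminated density at \<open>\<epsilon> = 0\<close> is \<open>\<pi>\<close> even where \<open>q\<close> vanishes, and \<open>\<epsilon> \<mapsto> r\<^sup>\<epsilon>\<close> is not
  differentiable at \<open>0\<close> if \<open>r = 0\<close>.\<close>

definition rpow :: "real \<Rightarrow> real \<Rightarrow> real" where
  "rpow a e = (if e = 0 then 1 else a powr e)"

definition geom_contam :: "'p measure \<Rightarrow> ('p \<Rightarrow> real) \<Rightarrow> ('p \<Rightarrow> real) \<Rightarrow> real \<Rightarrow> 'p \<Rightarrow> real" where
  "geom_contam \<mu> p q e \<theta> =
     rpow (p \<theta>) (1 - e) * rpow (q \<theta>) e / (\<integral>\<phi>. rpow (p \<phi>) (1 - e) * rpow (q \<phi>) e \<partial>\<mu>)"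

text \<open>The hypotheses of the theorem on differentiation under the integral sign, for a parameter
  ranging over an interval \<open>I\<close> (derivatives at an end point of \<open>I\<close> are one-sided).\<close>

definition dominated_derivative :: "'a measure \<Rightarrow> real set \<Rightarrow> (real \<Rightarrow> 'a \<Rightarrow> real) \<Rightarrow> bool" where
  "dominated_derivative M I g \<longleftrightarrow> (\<forall>e\<in>I. integrable M (g e)) \<and>
     (\<exists>g' h. integrable M h \<and>
        (AE z in M. \<forall>e\<in>I. ((\<lambda>e. g e z) has_real_derivative g' e z) (at e within I) \<and>
                            \<bar>g' e z\<bar> \<le> h z))"

text \<open>Consistency of the definition: \<open>\<pi>\<^sub>\<epsilon> = r\<^sup>\<epsilon> \<pi> / E\<^sub>\<pi>(r\<^sup>\<epsilon>)\<close>, and \<open>\<pi>\<^sub>0 = \<pi>\<close>.\<close>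

lemma rpow_ratio:
  assumes "0 \<le> a" "0 \<le> b" "e < 1"
  shows "rpow a (1 - e) * rpow b e = a * rpow (b / a) e"
proof (cases "a = 0")
  case False
  then have "a powr (1 - e) = a / a powr e" using assms by (simp add: powr_diff)
  then show ?thesis using assms False by (auto simp: rpow_def powr_divide)
qed (use assms in \<open>auto simp: rpow_def\<close>)

lemma measurable_rpow [measurable]:
  "f \<in> borel_measurable M \<Longrightarrow> (\<lambda>x. rpow (f x) e) \<in> borel_measurable M"
  unfolding rpow_def by simp

lemma geom_contam_eq:
  assumes "is_density \<mu> p" "is_density \<mu> q" "e < 1" "\<theta> \<in> space \<mu>"
  shows "geom_contam \<mu> p q e \<theta> =
    rpow (q \<theta> / p \<theta>) e * p \<theta> / (\<integral>\<phi>. rpow (q \<phi> / p \<phi>) e \<partial>prior_measure \<mu> p)"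
proof -
  have [measurable]: "p \<in> borel_measurable \<mu>" "q \<in> borel_measurable \<mu>"
    using assms by (auto simp: is_density_def)
  have "(\<integral>\<phi>. rpow (q \<phi> / p \<phi>) e \<partial>prior_measure \<mu> p) = (\<integral>\<phi>. p \<phi> * rpow (q \<phi> / p \<phi>) e \<partial>\<mu>)"
    unfolding prior_measure_def
    by (subst integral_real_density) (use assms in \<open>auto simp: is_density_def\<close>)
  also have "\<dots> = (\<integral>\<phi>. rpow (p \<phi>) (1 - e) * rpow (q \<phi>) e \<partial>\<mu>)"
    by (rule Bochner_Integration.integral_cong)
       (use assms in \<open>auto simp: is_density_def rpow_ratio\<close>)
  finally show ?thesis
    using assms rpow_ratio[of "p \<theta>" "q \<theta>" e]
    by (simp add: geom_contam_def is_density_def mult.commute)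
qed

lemma geom_contam_0:
  assumes "is_density \<mu> p" "is_density \<mu> q" "\<theta> \<in> space \<mu>"
  shows "geom_contam \<mu> p q 0 \<theta> = p \<theta>"
proof -
  have "prob_space (prior_measure \<mu> p)"
    unfolding prior_measure_def
    by (rule prob_spaceI) (use assms in \<open>auto simp: is_density_def emeasure_density cong: nn_integral_cong\<close>)
  then show ?thesis
    by (simp add: geom_contam_eq[OF assms(1,2) _ assms(3)] rpow_def prob_space.prob_space)
qed

end

theory Submission
  imports Defs
begin

text \<open>With \<open>p = \<pi>\<^sub>\<epsilon>(\<theta>)\<close> one has \<open>log BF = log (1 - p) + log RB - log (1 - p RB)\<close>, so only the derivatives
  at \<open>0\<close> of \<open>p\<close> and of the prior predictive density are needed.  Differentiability of \<open>r\<^sup>\<epsilon>\<close> at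
  \<open>0\<close> forces \<open>r > 0\<close> almost surely under the prior, hence at the atom \<open>\<theta>\<close>, and dominated convergence gives
  \<open>d/d\<epsilon> E\<^sub>\<pi>(r\<^sup>\<epsilon>) = E\<^sub>\<pi>(log r)\<close> and \<open>d/d\<epsilon> \<pi>\<^sub>\<epsilon> = \<pi> (log r - E\<^sub>\<pi>(log r))\<close>.  Since \<open>\<theta>\<close> has
  support measure \<open>1\<close>, the posterior probability \<open>p RB\<close> is at most \<open>1\<close>, and it is
  assumed to differ from \<open>1\<close>, so all logarithms have positive arguments near \<open>0\<close>.\<close>

text \<open>Along a sequence in \<open>I - {a}\<close> tending to \<open>a\<close>, the difference
  quotients are bounded by \<open>h\<close>, by the mean value inequality on the interval
  \<open>I\<close>, so dominated convergence applies. The derivative at \<open>a\<close> is passed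
  separately as \<open>u\<close> because \<open>dominated_derivative\<close> does not say that its
  \<open>g'\<close> is measurable.\<close>

lemma has_real_derivative_integral_dominated:
  fixes g :: "real \<Rightarrow> 'a \<Rightarrow> real"
  assumes dom: "dominated_derivative M I g" and I: "is_interval I" "a \<in> I"
    and u: "u \<in> borel_measurable M"
    and deriv: "AE z in M. ((\<lambda>e. g e z) has_real_derivative u z) (at a within I)"
  shows "((\<lambda>e. \<integral>z. g e z \<partial>M) has_real_derivative (\<integral>z. u z \<partial>M)) (at a within I)"
  unfolding has_field_derivative_iff tendsto_at_iff_sequentially
proof (intro allI impI)
  fix X :: "nat \<Rightarrow> real"
  assume X: "\<forall>i. X i \<in> I - {a}" "X \<longlonglongrightarrow> a"
  have int: "integrable M (g e)" if "e \<in> I" for e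
    using dom that by (auto simp: dominated_derivative_def)
  have X_I: "X i \<in> I" "X i \<noteq> a" for i
    using X(1) by auto
  obtain g' h where h: "integrable M h"
    and g': "AE z in M. \<forall>e\<in>I. ((\<lambda>e. g e z) has_real_derivative g' e z) (at e within I) \<and> \<bar>g' e z\<bar> \<le> h z"
    using dom by (auto simp: dominated_derivative_def)
  have "(\<lambda>i. \<integral>z. (g (X i) z - g a z) / (X i - a) \<partial>M) \<longlonglongrightarrow> (\<integral>z. u z \<partial>M)"
  proof (rule integral_dominated_convergence[OF u _ h])
    show "(\<lambda>z. (g (X i) z - g a z) / (X i - a)) \<in> borel_measurable M" for i
      using int[THEN borel_measurable_integrable] X_I I(2) by simp
    show "AE z in M. (\<lambda>i. (g (X i) z - g a z) / (X i - a)) \<longlonglongrightarrow> u z"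
      using deriv
    proof eventually_elim
      case (elim z)
      then show ?case
        using X unfolding has_field_derivative_iff tendsto_at_iff_sequentially by (auto simp: o_def)
    qed
    show "AE z in M. norm ((g (X i) z - g a z) / (X i - a)) \<le> h z" for i
      using g'
    proof eventually_elim
      case (elim z)
      have "norm (g (X i) z - g a z) \<le> h z * norm (X i - a)"
        by (rule field_differentiable_bound[of I _ "\<lambda>e. g' e z"])
          (use elim X_I I is_interval_convex in auto)
      then show ?case
        using X_I[of i] by (simp add: divide_le_eq)
    qed
  qed
  moreover have "(\<integral>z. (g (X i) z - g a z) / (X i - a) \<partial>M) =
      ((\<integral>z. g (X i) z \<partial>M) - (\<integral>z. g a z \<partial>M)) / (X i - a)" for i
    using int X_I I(2) by simp
  ultimately have "(\<lambda>i. ((\<integral>z. g (X i) z \<partial>M) - (\<integral>z. g a z \<partial>M)) / (X i - a)) \<longlonglongrightarrow> (\<integral>z. u z \<partial>M)"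
    by (simp only:)
  then show "((\<lambda>y. ((\<integral>z. g y z \<partial>M) - (\<integral>z. g a z \<partial>M)) / (y - a)) \<circ> X)
      \<longlonglongrightarrow> (\<integral>z. u z \<partial>M)"
    by (simp add: o_def)
qed

text \<open>An exceptional null set containing \<open>a\<close> would have at least the measure of
  \<open>{a}\<close>. This carries almost sure facts over to the point \<theta>.\<close>

lemma AE_atom:
  assumes "AE z in M. P z" "{a} \<in> sets M" "0 < emeasure M {a}"
  shows "P a"
proof (rule ccontr)
  assume "\<not> P a"
  moreover obtain Z where "{z \<in> space M. \<not> P z} \<subseteq> Z" "Z \<in> sets M" "emeasure M Z = 0"
    using assms(1) by (rule AE_E)
  moreover have "a \<in> space M"
    using assms(2) sets.sets_into_space by auto
  ultimately show False
    using emeasure_mono[of "{a}" Z M] assms(3) by auto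
qed

text \<open>A connected set with a second point has no isolated points. This makes limits within
  \<open>I\<close> unique.\<close>

lemma at_within_interval_nontrivial:
  fixes I :: "real set"
  assumes "is_interval I" "a \<in> I" "I \<noteq> {a}"
  shows "at a within I \<noteq> bot"
  using connected_imp_perfect[of I a] assms is_interval_connected
  by (auto simp: trivial_limit_within)

text \<open>For \<open>a = 0\<close> the function jumps from 0 to the conventional value 1 at
  exponent 0, so it is not even continuous there.\<close>

lemma rpow_differentiable_imp_pos:
  assumes "0 \<le> a" "at 0 within I \<noteq> bot"
    and "((\<lambda>e. rpow a e) has_real_derivative D) (at 0 within I)"
  shows "0 < a"
proof (rule ccontr)
  assume "\<not> 0 < a"
  with \<open>0 \<le> a\<close> have [simp]: "a = 0" by simp
  have "((\<lambda>e. rpow a e) \<longlongrightarrow> 1) (at 0 within I)"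
    using DERIV_continuous[OF assms(3)] by (simp add: continuous_within rpow_def)
  moreover have "((\<lambda>e. rpow a e) \<longlongrightarrow> 0) (at 0 within I)"
    by (rule tendsto_eventually) (auto simp: eventually_at_filter rpow_def)
  ultimately show False
    using tendsto_unique[OF assms(2)] by force
qed

lemma rpow_has_real_derivative:
  assumes "0 < a"
  shows "((\<lambda>e. rpow a e) has_real_derivative ln a) (at 0 within I)"
proof -
  have "(\<lambda>e. rpow a e) = (\<lambda>e. exp (e * ln a))"
    using assms by (auto simp: rpow_def powr_def)
  moreover have "((\<lambda>e. exp (e * ln a)) has_real_derivative ln a) (at 0 within I)"
    by (auto intro!: derivative_eq_intros)
  ultimately show ?thesis by simp
qed

lemma prob_space_prior_measure:
  "is_density \<mu> p \<Longrightarrow> prob_space (prior_measure \<mu> p)"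
  unfolding prior_measure_def
  by (rule prob_spaceI) (auto simp: is_density_def emeasure_density cong: nn_integral_cong)

text \<open>Quotient rule for \<open>r^e * p / E(r^e)\<close>, whose denominator is 1 at
  \<open>e = 0\<close>. Positivity of the ratio is asked only where \<open>p\<close> is positive: at
  a zero of \<open>p\<close> the quotient and the claimed derivative both vanish.\<close>

lemma geom_contam_has_real_derivative:
  assumes p: "is_density \<mu> p" and q: "is_density \<mu> q" and \<phi>: "\<phi> \<in> space \<mu>"
    and pos: "0 < p \<phi> \<Longrightarrow> 0 < q \<phi> / p \<phi>" and "0 \<in> I"
    and E: "((\<lambda>e. \<integral>\<psi>. rpow (q \<psi> / p \<psi>) e \<partial>prior_measure \<mu> p) has_real_derivative c) (at 0 within I)"
  shows "((\<lambda>e. geom_contam \<mu> p q e \<phi>) has_real_derivative p \<phi> * (ln (q \<phi> / p \<phi>) - c)) (at 0 within I)"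
proof (rule has_field_derivative_transform_within)
  let ?E = "\<lambda>e. \<integral>\<psi>. rpow (q \<psi> / p \<psi>) e \<partial>prior_measure \<mu> p"
  have E0: "?E 0 = 1"
    using prob_space_prior_measure[OF p] by (simp add: rpow_def prob_space.prob_space)
  have "0 \<le> p \<phi>"
    using p \<phi> by (auto simp: is_density_def)
  show "((\<lambda>e. rpow (q \<phi> / p \<phi>) e * p \<phi> / ?E e) has_real_derivative p \<phi> * (ln (q \<phi> / p \<phi>) - c)) (at 0 within I)"
  proof (cases "p \<phi> = 0")
    case False
    then have "0 < q \<phi> / p \<phi>"
      using pos \<open>0 \<le> p \<phi>\<close> by simp
    note rpow_has_real_derivative[OF this, of I, derivative_intros]
    show ?thesis
      by (rule derivative_eq_intros E refl)+ (use E0 in \<open>simp_all add: rpow_def algebra_simps\<close>)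
  qed simp
  \<comment> \<open>\<open>geom_contam_eq\<close> is stated for \<open>e < 1\<close>; radius 1
    around 0 stays in that range.\<close>
  show "rpow (q \<phi> / p \<phi>) e * p \<phi> / ?E e = geom_contam \<mu> p q e \<phi>"
    if "e \<in> I" "dist e 0 < 1" for e
    using geom_contam_eq[OF p q _ \<phi>, of e] that by (simp add: dist_real_def)
qed (use \<open>0 \<in> I\<close> in auto)

text \<open>The terms in \<open>R'\<close> sum to \<open>R' / R * 1 / (1 - p R)\<close>, where
  \<open>1 / (1 - p R) = 1 + p / (1 - p) * B\<close>. Those in \<open>p'\<close> are
  \<open>- p' / (1 - p) + p' * R / (1 - p R)\<close>, where
  \<open>R / (1 - p R) = B / (1 - p)\<close>.\<close>

lemma ln_odds_ratio_has_real_derivative: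
  fixes p R :: "real \<Rightarrow> real"
  assumes p: "(p has_real_derivative p') (at a within I)"
    and R: "(R has_real_derivative R') (at a within I)"
    and pos: "0 < R a" "p a < 1" "p a * R a < 1"
  defines "B \<equiv> (1 - p a) * R a / (1 - p a * R a)"
  shows "((\<lambda>e. ln ((1 - p e) * R e / (1 - p e * R e))) has_real_derivative
      R' / R a * (1 + p a / (1 - p a) * B) - p' / (1 - p a) * (1 - B)) (at a within I)"
proof -
  have "0 < B"
    using pos by (simp add: B_def)
  \<comment> \<open>Nonzero denominators for clearing fractions below; the product appears in both
    orders so that either form is recognised.\<close>
  have [simp]: "p a \<noteq> 1" "p a * R a \<noteq> 1" "R a * p a \<noteq> 1" "R a \<noteq> 0"
    using pos by (auto simp: mult.commute)
  let ?D = "((- p' * R a + (1 - p a) * R') * (1 - p a * R a)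
      + (1 - p a) * R a * (p' * R a + p a * R')) / (1 - p a * R a)\<^sup>2"
  have "((\<lambda>e. (1 - p e) * R e / (1 - p e * R e)) has_real_derivative ?D) (at a within I)"
    by (rule derivative_eq_intros p R refl)+
      (use pos in \<open>auto simp: power2_eq_square algebra_simps\<close>)
  then have "((\<lambda>e. ln ((1 - p e) * R e / (1 - p e * R e))) has_real_derivative 1 / B * ?D) (at a within I)"
    using \<open>0 < B\<close> unfolding B_def
    by (intro DERIV_chain2[where f = ln]) (auto intro!: derivative_eq_intros)
  moreover have "1 / B * ?D = R' / R a * (1 + p a / (1 - p a) * B) - p' / (1 - p a) * (1 - B)"
    unfolding B_def by (simp add: divide_simps power2_eq_square) (simp add: algebra_simps)
  ultimately show ?thesis by simp
qed

theorem proposition9: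
  fixes \<mu> :: "'p measure" and P :: "'p \<Rightarrow> 'x measure" and X :: "'x measure"
    and N :: "'t measure" and T :: "'x \<Rightarrow> 't" and f :: "'p \<Rightarrow> 't \<Rightarrow> real"
    and \<pi> q r :: "'p \<Rightarrow> real" and \<theta> :: 'p and x :: 'x and I :: "real set"
    and \<pi>\<epsilon> :: "real \<Rightarrow> 'p \<Rightarrow> real" and RB BF :: "real \<Rightarrow> real"
  assumes model: "statistical_model (space \<mu>) P X"
    and T: "minimal_sufficient_statistic (space \<mu>) P X N T"
    and f_nonneg: "\<And>\<phi> t. \<phi> \<in> space \<mu> \<Longrightarrow> t \<in> space N \<Longrightarrow> 0 \<le> f \<phi> t"
    and f_density: "\<And>\<phi>. \<phi> \<in> space \<mu> \<Longrightarrow> distributed (P \<phi>) N T (\<lambda>t. ennreal (f \<phi> t))"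
    and x: "x \<in> space X"
    and prior: "is_density \<mu> \<pi>"
    and q: "is_density \<mu> q"
    and \<theta>: "\<theta> \<in> space \<mu>" "{\<theta>} \<in> sets \<mu>"
    and atom: "emeasure (prior_measure \<mu> \<pi>) {\<theta>} = ennreal (\<pi> \<theta>)" "0 < \<pi> \<theta>" "\<pi> \<theta> < 1"
    and I: "is_interval I" "0 \<in> I" "I \<noteq> {0}"
    and finite: "\<And>e. e \<in> I \<Longrightarrow> integrable \<mu> (\<lambda>\<phi>. rpow (\<pi> \<phi>) (1 - e) * rpow (q \<phi>) e)"
    and r_def: "r = (\<lambda>\<phi>. q \<phi> / \<pi> \<phi>)"
    and \<pi>\<epsilon>_def: "\<pi>\<epsilon> = geom_contam \<mu> \<pi> q"
    and dom_r: "dominated_derivative (prior_measure \<mu> \<pi>) I (\<lambda>e \<phi>. rpow (r \<phi>) e)"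
    and dom_m: "dominated_derivative \<mu> I (\<lambda>e \<phi>. f \<phi> (T x) * \<pi>\<epsilon> e \<phi>)"
    and RB_def: "RB = (\<lambda>e. relative_belief \<mu> f (\<pi>\<epsilon> e) \<theta> (T x))"
    and BF_def: "BF = (\<lambda>e. bayes_factor \<mu> f (\<pi>\<epsilon> e) \<theta> (T x))"
    and f_pos: "0 < f \<theta> (T x)"
    and post: "\<pi> \<theta> * relative_belief \<mu> f \<pi> \<theta> (T x) \<noteq> 1"
  shows "\<exists>dRB. ((\<lambda>e. ln (RB e)) has_real_derivative dRB) (at 0 within I) \<and>
           ((\<lambda>e. ln (BF e)) has_real_derivative
              dRB * (1 + \<pi> \<theta> / (1 - \<pi> \<theta>) * bayes_factor \<mu> f \<pi> \<theta> (T x))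
              + ((\<integral>\<phi>. ln (r \<phi>) \<partial>prior_measure \<mu> \<pi>) - ln (r \<theta>)) * (\<pi> \<theta> / (1 - \<pi> \<theta>))
                * (1 - bayes_factor \<mu> f \<pi> \<theta> (T x)))
             (at 0 within I)"
proof -
  interpret prior: prob_space "prior_measure \<mu> \<pi>"
    by (rule prob_space_prior_measure[OF prior])
  have [measurable]: "\<pi> \<in> borel_measurable \<mu>" "q \<in> borel_measurable \<mu>"
    using prior q by (auto simp: is_density_def)
  have nonneg: "0 \<le> \<pi> \<phi>" "0 \<le> q \<phi>" "0 \<le> r \<phi>" if "\<phi> \<in> space \<mu>" for \<phi>
    using prior q that by (auto simp: is_density_def r_def)
  have [measurable]: "r \<in> borel_measurable \<mu>"
    unfolding r_def by simp
  have nontrivial: "at 0 within I \<noteq> bot"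
    using at_within_interval_nontrivial I by simp
  \<comment> \<open>Only the existence of a derivative is taken from \<open>dom_r\<close>; its value
    \<open>ln (r \<phi>)\<close> follows once \<open>r \<phi>\<close> is known to be
    positive.\<close>
  have "AE \<phi> in prior_measure \<mu> \<pi>. \<exists>D. ((\<lambda>e. rpow (r \<phi>) e) has_real_derivative D) (at 0 within I)"
    using dom_r I(2) unfolding dominated_derivative_def by (auto elim!: eventually_mono)
  then have r_pos: "AE \<phi> in prior_measure \<mu> \<pi>. 0 < r \<phi>"
    using AE_space
  proof eventually_elim
    case (elim \<phi>)
    then show ?case
      using rpow_differentiable_imp_pos[OF nonneg(3) nontrivial] by (auto simp: prior_measure_def)
  qed
  \<comment> \<open>A null set of the prior may have positive \<mu>-measure, so with respect to
    \<mu> the positivity of \<open>r\<close> is known only where \<pi> is positive. This suffices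
    for the integral over \<mu>, since the contaminated density vanishes near \<open>e = 0\<close>
    where \<pi> does.\<close>
  have r_pos_\<mu>: "AE \<phi> in \<mu>. 0 < \<pi> \<phi> \<longrightarrow> 0 < r \<phi>"
    using r_pos unfolding prior_measure_def by (simp add: AE_density)
  have r_\<theta>: "0 < r \<theta>"
    by (rule AE_atom[OF r_pos]) (use \<theta> atom in \<open>auto simp: prior_measure_def\<close>)
  define c where "c = (\<integral>\<phi>. ln (r \<phi>) \<partial>prior_measure \<mu> \<pi>)"
  have E: "((\<lambda>e. \<integral>\<phi>. rpow (r \<phi>) e \<partial>prior_measure \<mu> \<pi>) has_real_derivative c) (at 0 within I)"
    unfolding c_def
  proof (rule has_real_derivative_integral_dominated[OF dom_r I(1,2)])
    show "(\<lambda>\<phi>. ln (r \<phi>)) \<in> borel_measurable (prior_measure \<mu> \<pi>)"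
      unfolding prior_measure_def by simp
    show "AE \<phi> in prior_measure \<mu> \<pi>. ((\<lambda>e. rpow (r \<phi>) e) has_real_derivative ln (r \<phi>)) (at 0 within I)"
      using r_pos by eventually_elim (rule rpow_has_real_derivative)
  qed
  have \<pi>\<epsilon>_deriv: "((\<lambda>e. \<pi>\<epsilon> e \<phi>) has_real_derivative \<pi> \<phi> * (ln (r \<phi>) - c)) (at 0 within I)"
    if "\<phi> \<in> space \<mu>" "0 < \<pi> \<phi> \<Longrightarrow> 0 < r \<phi>" for \<phi>
    using geom_contam_has_real_derivative[OF prior q that(1) _ I(2)] that(2) E
    unfolding r_def \<pi>\<epsilon>_def by simp
  have \<pi>\<epsilon>_0: "\<pi>\<epsilon> 0 \<phi> = \<pi> \<phi>" if "\<phi> \<in> space \<mu>" for \<phi>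
    unfolding \<pi>\<epsilon>_def by (rule geom_contam_0[OF prior q that])
  \<comment> \<open>The case \<open>e = 0\<close> of \<open>dom_m\<close>. It yields the
    measurability of the integrand of \<open>m'\<close> and the integrability behind the lower bound
    on \<open>m 0\<close>.\<close>
  have int: "integrable \<mu> (\<lambda>\<phi>. f \<phi> (T x) * \<pi> \<phi>)"
    using dom_m I(2) \<pi>\<epsilon>_0
    by (auto simp: dominated_derivative_def cong: Bochner_Integration.integrable_cong)
  define m where "m e = prior_predictive \<mu> f (\<pi>\<epsilon> e) (T x)" for e
  define m' where "m' = (\<integral>\<phi>. f \<phi> (T x) * \<pi> \<phi> * (ln (r \<phi>) - c) \<partial>\<mu>)"
  have m: "(m has_real_derivative m') (at 0 within I)"
    unfolding m_def[abs_def] m'_def prior_predictive_def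
  proof (rule has_real_derivative_integral_dominated[OF dom_m I(1,2)])
    show "(\<lambda>\<phi>. f \<phi> (T x) * \<pi> \<phi> * (ln (r \<phi>) - c)) \<in> borel_measurable \<mu>"
      using borel_measurable_integrable[OF int] by simp
    show "AE \<phi> in \<mu>. ((\<lambda>e. f \<phi> (T x) * \<pi>\<epsilon> e \<phi>) has_real_derivative
        f \<phi> (T x) * \<pi> \<phi> * (ln (r \<phi>) - c)) (at 0 within I)"
      using r_pos_\<mu> AE_space
    proof eventually_elim
      case (elim \<phi>)
      then show ?case
        using DERIV_cmult[OF \<pi>\<epsilon>_deriv, of \<phi> "f \<phi> (T x)"] by (simp add: mult.assoc)
    qed
  qed
  have m_0: "m 0 = (\<integral>\<phi>. f \<phi> (T x) * \<pi> \<phi> \<partial>\<mu>)"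
    unfolding m_def prior_predictive_def
    by (rule Bochner_Integration.integral_cong) (simp_all add: \<pi>\<epsilon>_0)
  have "T x \<in> space N"
    using T x by (auto simp: minimal_sufficient_statistic_def sufficient_statistic_def dest: measurable_space)
  \<comment> \<open>The prior mass of the atom is its density times its support measure; cancelling
    the positive finite density leaves support measure 1.\<close>
  have "ennreal (\<pi> \<theta>) * emeasure \<mu> {\<theta>} = ennreal (\<pi> \<theta>) * 1"
    using atom(1) \<theta> by (simp add: prior_measure_def emeasure_density nn_integral_indicator_singleton)
  then have \<mu>_\<theta>: "emeasure \<mu> {\<theta>} = 1"
    using atom(2) by (subst (asm) ennreal_mult_cancel_left) (auto simp: ennreal_eq_0_iff)
  \<comment> \<open>Keeping only the atom's contribution to the nonnegative integral
    \<open>m 0\<close> shows both that \<open>m 0\<close> is positive and that the posterior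
    probability of \<theta> is at most 1.\<close>
  have "f \<theta> (T x) * \<pi> \<theta> = (\<integral>\<phi>. f \<theta> (T x) * \<pi> \<theta> * indicator {\<theta>} \<phi> \<partial>\<mu>)"
    using \<mu>_\<theta> \<theta> by (simp add: measure_def)
  also have "\<dots> \<le> m 0"
    unfolding m_0
  proof (rule integral_mono[OF _ int])
    show "integrable \<mu> (\<lambda>\<phi>. f \<theta> (T x) * \<pi> \<theta> * indicator {\<theta>} \<phi>)"
      using \<mu>_\<theta> \<theta> by (auto intro!: integrable_real_indicator)
  qed (use f_nonneg \<open>T x \<in> space N\<close> nonneg in \<open>auto simp: indicator_def\<close>)
  finally have le: "f \<theta> (T x) * \<pi> \<theta> \<le> m 0" .
  then have m_pos: "0 < m 0"
    using mult_pos_pos[OF f_pos atom(2)] by linarith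
  have RB_eq: "RB = (\<lambda>e. f \<theta> (T x) / m e)"
    by (simp add: RB_def relative_belief_def m_def)
  have m_\<pi>: "prior_predictive \<mu> f \<pi> (T x) = m 0"
    by (simp add: m_0 prior_predictive_def)
  have RB_0: "relative_belief \<mu> f \<pi> \<theta> (T x) = RB 0"
    by (simp add: relative_belief_def m_\<pi> RB_eq)
  have RB_pos: "0 < RB 0"
    using f_pos m_pos by (simp add: RB_eq)
  have "\<pi> \<theta> * RB 0 \<le> 1"
    using le m_pos by (simp add: RB_eq divide_le_eq mult.commute)
  \<comment> \<open>\<open>post\<close> excludes equality, so the denominator of the Bayes factor is
    positive.\<close>
  then have less: "\<pi> \<theta> * RB 0 < 1"
    using post RB_0 by simp
  define RB' where "RB' = - f \<theta> (T x) * m' / (m 0)\<^sup>2"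
  have RB: "(RB has_real_derivative RB') (at 0 within I)"
    unfolding RB_eq RB'_def
    by (rule derivative_eq_intros m refl)+ (use m_pos in \<open>auto simp: power2_eq_square\<close>)
  \<comment> \<open>The witness for \<open>dRB\<close>; it equals \<open>- m' / m 0\<close>.\<close>
  have "((\<lambda>e. ln (RB e)) has_real_derivative RB' / RB 0) (at 0 within I)"
    using DERIV_chain2[OF DERIV_ln_divide[OF RB_pos] RB] by simp
  moreover have "((\<lambda>e. ln (BF e)) has_real_derivative
      RB' / RB 0 * (1 + \<pi> \<theta> / (1 - \<pi> \<theta>) * bayes_factor \<mu> f \<pi> \<theta> (T x))
      + (c - ln (r \<theta>)) * (\<pi> \<theta> / (1 - \<pi> \<theta>)) * (1 - bayes_factor \<mu> f \<pi> \<theta> (T x))) (at 0 within I)"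
  proof -
    have "BF = (\<lambda>e. (1 - \<pi>\<epsilon> e \<theta>) * RB e / (1 - \<pi>\<epsilon> e \<theta> * RB e))"
      by (simp add: BF_def RB_def bayes_factor_def)
    moreover have "bayes_factor \<mu> f \<pi> \<theta> (T x) = (1 - \<pi> \<theta>) * RB 0 / (1 - \<pi> \<theta> * RB 0)"
      by (simp add: bayes_factor_def RB_0)
    \<comment> \<open>With \<open>p' = \<pi> \<theta> * (ln (r \<theta>) - c)\<close>, the minus
      sign before the \<open>p'\<close> term is absorbed by swapping \<open>c\<close> and
      \<open>ln (r \<theta>)\<close>.\<close>
    moreover have "s - \<pi> \<theta> * (ln (r \<theta>) - c) / (1 - \<pi> \<theta>) * (1 - b) =
        s + (c - ln (r \<theta>)) * (\<pi> \<theta> / (1 - \<pi> \<theta>)) * (1 - b)" for s b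
      using atom(3) by (simp add: divide_simps) (simp add: algebra_simps)
    ultimately show ?thesis
      using ln_odds_ratio_has_real_derivative[OF \<pi>\<epsilon>_deriv[OF \<theta>(1) r_\<theta>] RB RB_pos]
        atom(3) less by (simp only: \<pi>\<epsilon>_0[OF \<theta>(1)])
  qed
  ultimately show ?thesis
    unfolding c_def by blast
qed

end
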